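(* Let $n$ be a positive integer and suppose that there exists a PC-graph (pseudo-cyclic strongly regular graph) of order $2n-1$. Then $$R(B_n,B_n)\ge 4n+1.$$
   Context: For a positive integer $n$, the book graph $B_n=K_2+\overline{K}_n$ is the graph consisting of $n$ triangles sharing a common edge. The Ramsey number $R(B_m,B_n)$ is the smallest integer $N$ such that every red/blue coloring of the edges of $K_N$ contains a red copy of $B_m$ or a blue copy of $B_n$ (copies are as not necessarily induced subgraphs). A strongly regular graph $\mathrm{srg}(\nu,k,\lambda,\mu)$ is a $k$-regular graph on $\nu$ vertices in which every pair of adjacent vertices has exactly $\lambda$ common neighbors and every pair of distinct non-adjacent vertices has exactly $\mu$ common neighbors. A pseudo-cyclic strongly regular graph (PC-graph) of order $\nu$ is a strongly regular graph $\mathrm{srg}\left(\nu,\frac{\nu-1}{2},\frac{\nu-5}{4},\frac{\nu-1}{4}\right)$. *)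

theory Defs
  imports Complex_Main "HOL-Library.Ramsey"
begin

text \<open>A graph is a pair of a vertex set and a set of edges, the edges being two-element
  sets of vertices.\<close>

type_synonym 'a ugraph = "'a set \<times> 'a set set"

abbreviation verts :: "'a ugraph \<Rightarrow> 'a set" where
  "verts G \<equiv> fst G"

abbreviation edges :: "'a ugraph \<Rightarrow> 'a set set" where
  "edges G \<equiv> snd G"

definition finite_simple_graph :: "'a ugraph \<Rightarrow> bool" where
  "finite_simple_graph G \<longleftrightarrow> finite (verts G) \<and> edges G \<subseteq> nsets (verts G) 2"

definition nbhd :: "'a ugraph \<Rightarrow> 'a \<Rightarrow> 'a set" where
  "nbhd G v = {u \<in> verts G. {u, v} \<in> edges G}"

definition complete_graph :: "nat \<Rightarrow> nat ugraph" where
  "complete_graph n = ({..<n}, nsets {..<n} 2)"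

definition graph_complement :: "'a ugraph \<Rightarrow> 'a ugraph" where
  "graph_complement G = (verts G, nsets (verts G) 2 - edges G)"

definition graph_join :: "'a ugraph \<Rightarrow> 'b ugraph \<Rightarrow> ('a + 'b) ugraph" where
  "graph_join G H =
    (verts G <+> verts H,
     (image Inl) ` edges G \<union> (image Inr) ` edges H
       \<union> {{Inl x, Inr y} | x y. x \<in> verts G \<and> y \<in> verts H})"

definition book_graph :: "nat \<Rightarrow> (nat + nat) ugraph" where
  "book_graph n = graph_join (complete_graph 2) (graph_complement (complete_graph n))"

text \<open>A copy of \<open>H\<close> in \<open>G\<close> is a subgraph that need not be induced.\<close>

definition contains_copy :: "'a ugraph \<Rightarrow> 'b ugraph \<Rightarrow> bool" where
  "contains_copy G H \<longleftrightarrow>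
    (\<exists>f. inj_on f (verts H) \<and> f ` verts H \<subseteq> verts G \<and> (\<forall>e\<in>edges H. f ` e \<in> edges G))"

datatype colour = Red | Blue

definition colour_class :: "nat \<Rightarrow> (nat set \<Rightarrow> colour) \<Rightarrow> colour \<Rightarrow> nat ugraph" where
  "colour_class N c i =
    (verts (complete_graph N), {e \<in> edges (complete_graph N). c e = i})"

definition ramsey_number :: "'a ugraph \<Rightarrow> 'b ugraph \<Rightarrow> nat" where
  "ramsey_number G H =
    (LEAST N. \<forall>c. contains_copy (colour_class N c Red) G
                 \<or> contains_copy (colour_class N c Blue) H)"

text \<open>The parameters are real so that \<open>(\<nu> - 1) / 2\<close>, \<open>(\<nu> - 5) / 4\<close> and \<open>(\<nu> - 1) / 4\<close> below
  involve neither truncated subtraction nor rounded division. There is no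
  non-degeneracy condition; in particular the one-vertex graph is pseudo-cyclic of order 1,
  the condition on adjacent pairs being vacuous.\<close>

definition strongly_regular ::
    "'a ugraph \<Rightarrow> nat \<Rightarrow> real \<Rightarrow> real \<Rightarrow> real \<Rightarrow> bool" where
  "strongly_regular G \<nu> k l \<mu> \<longleftrightarrow>
    finite_simple_graph G \<and> card (verts G) = \<nu> \<and>
    (\<forall>v\<in>verts G. real (card (nbhd G v)) = k) \<and>
    (\<forall>u\<in>verts G. \<forall>v\<in>verts G. u \<noteq> v \<longrightarrow> {u, v} \<in> edges G \<longrightarrow>
        real (card (nbhd G u \<inter> nbhd G v)) = l) \<and>
    (\<forall>u\<in>verts G. \<forall>v\<in>verts G. u \<noteq> v \<longrightarrow> {u, v} \<notin> edges G \<longrightarrow>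
        real (card (nbhd G u \<inter> nbhd G v)) = \<mu>)"

definition pc_graph :: "'a ugraph \<Rightarrow> nat \<Rightarrow> bool" where
  "pc_graph G \<nu> \<longleftrightarrow>
    strongly_regular G \<nu> ((real \<nu> - 1) / 2) ((real \<nu> - 5) / 4) ((real \<nu> - 1) / 4)"

end

theory Submission
  imports Defs
begin

text \<open>Encode a red/blue colouring of a complete graph on \<open>4n\<close> vertices by a symmetric matrix \<open>S\<close> with
  zero diagonal and entries \<open>\<plusminus>1\<close> elsewhere, and let \<open>t\<close> be its vector of row sums. Expanding
  \<open>\<Sum>\<^sub>z (1 + s S\<^sub>x\<^sub>z) (1 + s S\<^sub>y\<^sub>z)\<close> with \<open>s = S\<^sub>x\<^sub>y\<close> shows that the edge \<open>xy\<close> is the spine of a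
  monochromatic book with exactly
  \<open>n - 1 + (s (t\<^sub>x + t\<^sub>y) + (S\<^sup>2)\<^sub>x\<^sub>y) / 4\<close> pages, so it suffices that
  \<open>s (t\<^sub>x + t\<^sub>y) + (S\<^sup>2)\<^sub>x\<^sub>y \<le> 0\<close> for all \<open>x \<noteq> y\<close>.

  The \<open>\<plusminus>1\<close> adjacency matrix \<open>Q\<close> of a PC-graph has zero row sums and satisfies \<open>Q\<^sup>2 = \<nu> I - J\<close>.
  Remove one vertex \<open>v\<close>, let \<open>r\<close> be the corresponding column of \<open>Q\<close>, and put \<open>Q\<close> and \<open>-Q\<close> on two
  copies of the remaining vertices, with \<open>Q + diag r\<close> between the copies. Four further vertices,
  attached by the vectors \<open>\<plusminus>(1, -1)\<close> and \<open>\<plusminus>(r, r)\<close>, bring the order to \<open>2 (2n - 2) + 4 = 4n\<close>; their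
  contribution to \<open>S\<^sup>2\<close> compensates both the \<open>-J\<close> and the removal of \<open>v\<close>.\<close>

section \<open>Signed graphs without monochromatic books\<close>

lemma monochromatic_codegree_bound:
  fixes S :: "'b \<Rightarrow> 'b \<Rightarrow> int"
  assumes W: "finite W" "card W = 4 * n"
    and diag: "\<And>x. x \<in> W \<Longrightarrow> S x x = 0"
    and sign: "\<And>x y. x \<in> W \<Longrightarrow> y \<in> W \<Longrightarrow> x \<noteq> y \<Longrightarrow> S x y = 1 \<or> S x y = -1"
    and xy: "x \<in> W" "y \<in> W" "x \<noteq> y" and sym: "S y x = S x y"
    and bal: "S x y * ((\<Sum>l\<in>W. S x l) + (\<Sum>l\<in>W. S y l)) + (\<Sum>l\<in>W. S x l * S y l) \<le> 0"
  shows "card {z \<in> W - {x, y}. S x z = S x y \<and> S y z = S x y} < n"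
proof -
  define s where "s = S x y"
  let ?C = "{z \<in> W - {x, y}. S x z = s \<and> S y z = s}"
  have s: "s = 1 \<or> s = -1" using sign[OF xy] by (simp add: s_def)
  then have ss: "s * s = 1" by auto
  \<comment> \<open>Each factor is 2 when the edge has sign \<open>s\<close> and 0
    otherwise.\<close>
  have "(\<Sum>z\<in>W - {x, y}. (1 + s * S x z) * (1 + s * S y z)) =
      (\<Sum>z\<in>W - {x, y}. if S x z = s \<and> S y z = s then 4 else 0)"
  proof (rule sum.cong[OF refl])
    fix z assume "z \<in> W - {x, y}"
    then show "(1 + s * S x z) * (1 + s * S y z) = (if S x z = s \<and> S y z = s then 4 else 0)"
      using sign[of x z] sign[of y z] xy s by auto
  qed
  also have "\<dots> = 4 * int (card ?C)"
    using W(1) by (simp flip: sum.inter_filter)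
  finally have "4 * int (card ?C) = (\<Sum>z\<in>W - {x, y}. (1 + s * S x z) * (1 + s * S y z))" ..
  \<comment> \<open>The terms at \<open>x\<close> and \<open>y\<close> are each
    \<open>(1 + 0) * (1 + s * s) = 2\<close>.\<close>
  also have "\<dots> = (\<Sum>z\<in>W. (1 + s * S x z) * (1 + s * S y z)) - 4"
    using xy W(1) diag ss sym by (simp add: sum_diff s_def)
  also have "(\<Sum>z\<in>W. (1 + s * S x z) * (1 + s * S y z)) =
      (\<Sum>z\<in>W. 1 + (s * (S x z + S y z) + S x z * S y z))"
    by (rule sum.cong[OF refl]) (use s in \<open>auto simp: algebra_simps\<close>)
  also have "\<dots> = 4 * int n + (s * ((\<Sum>l\<in>W. S x l) + (\<Sum>l\<in>W. S y l)) + (\<Sum>l\<in>W. S x l * S y l))"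
    using W(2) by (simp add: sum.distrib sum_distrib_left distrib_left)
  also have "\<dots> \<le> 4 * int n" using bal by (simp add: s_def)
  finally show ?thesis by (simp add: s_def)
qed

section \<open>Doubling a conference graph\<close>

text \<open>The poles are the four additional vertices: \<open>HPole\<close> sees the two copies with opposite signs,
  \<open>RPole\<close> sees both copies through \<open>r\<close>.\<close>

datatype 'a dvert = Top 'a | Bot 'a | HPole bool | RPole bool

definition sg :: "bool \<Rightarrow> int" where
  "sg b = (if b then 1 else -1)"

locale conference_graph =
  fixes V :: "'a set" and Q :: "'a \<Rightarrow> 'a \<Rightarrow> int" and v :: 'a
  assumes fin: "finite V" and v: "v \<in> V"
    and diag: "i \<in> V \<Longrightarrow> Q i i = 0"
    and sign: "i \<in> V \<Longrightarrow> j \<in> V \<Longrightarrow> i \<noteq> j \<Longrightarrow> Q i j = 1 \<or> Q i j = -1"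
    and sym: "i \<in> V \<Longrightarrow> j \<in> V \<Longrightarrow> Q i j = Q j i"
    and row: "i \<in> V \<Longrightarrow> (\<Sum>l\<in>V. Q i l) = 0"
    and prod: "i \<in> V \<Longrightarrow> j \<in> V \<Longrightarrow> i \<noteq> j \<Longrightarrow> (\<Sum>l\<in>V. Q i l * Q j l) = -1"
begin

abbreviation V' :: "'a set" where "V' \<equiv> V - {v}"

abbreviation r :: "'a \<Rightarrow> int" where "r i \<equiv> Q i v"

section \<open>Row identities after deletion of \<open>v\<close>\<close>

lemma r_sq: "i \<in> V' \<Longrightarrow> r i * r i = 1"
  using sign[of i v] v by auto

lemma r_sum: "(\<Sum>l\<in>V'. r l) = 0"
proof -
  have "(\<Sum>l\<in>V'. r l) = (\<Sum>l\<in>V'. Q v l)"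
    by (rule sum.cong) (use sym v in auto)
  also have "\<dots> = 0" using row[OF v] fin v diag by (simp add: sum_diff)
  finally show ?thesis .
qed

lemma row_sums:
  assumes "i \<in> V'"
  shows "(\<Sum>l\<in>V'. Q i l) = - r i" "(\<Sum>l\<in>V'. Q i l * r l) = -1"
proof -
  show "(\<Sum>l\<in>V'. Q i l) = - r i"
    using row[of i] assms fin v by (simp add: sum_diff)
  have "(\<Sum>l\<in>V'. Q i l * r l) = (\<Sum>l\<in>V'. Q i l * Q v l)"
    by (rule sum.cong) (use sym v in auto)
  also have "\<dots> = -1" using prod[of i v] assms fin v diag by (simp add: sum_diff)
  finally show "(\<Sum>l\<in>V'. Q i l * r l) = -1" .
qed

lemma prod_sum:
  assumes "i \<in> V'" "j \<in> V'" "i \<noteq> j"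
  shows "(\<Sum>l\<in>V'. Q i l * Q j l) = -1 - r i * r j"
  using prod[of i j] assms fin v by (simp add: sum_diff)

text \<open>Since \<open>Q i i = 0\<close>, the block \<open>Q\<close> alone would give the pair
  \<open>Top i\<close>, \<open>Bot i\<close> no sign; \<open>r i\<close> supplies it. The signs
  among the poles make every pole row sum to 1.\<close>

fun S :: "'a dvert \<Rightarrow> 'a dvert \<Rightarrow> int" where
  "S (Top i) (Top j) = Q i j"
| "S (Bot i) (Bot j) = - Q i j"
| "S (Top i) (Bot j) = Q i j + (if j = i then r i else 0)"
| "S (Bot i) (Top j) = Q i j + (if j = i then r i else 0)"
| "S (Top i) (HPole b) = sg b"
| "S (HPole b) (Top i) = sg b"
| "S (Bot i) (HPole b) = - sg b"
| "S (HPole b) (Bot i) = - sg b"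
| "S (Top i) (RPole b) = sg b * r i"
| "S (RPole b) (Top i) = sg b * r i"
| "S (Bot i) (RPole b) = sg b * r i"
| "S (RPole b) (Bot i) = sg b * r i"
| "S (HPole b) (HPole c) = (if b = c then 0 else 1)"
| "S (RPole b) (RPole c) = (if b = c then 0 else 1)"
| "S (HPole b) (RPole c) = sg b * sg c"
| "S (RPole b) (HPole c) = sg b * sg c"

definition W :: "'a dvert set" where
  "W = Top ` V' \<union> Bot ` V' \<union> {HPole True, HPole False, RPole True, RPole False}"

lemma finite_W: "finite W"
  by (simp add: W_def fin)

lemma W_simps [simp]:
  "Top i \<in> W \<longleftrightarrow> i \<in> V'" "Bot i \<in> W \<longleftrightarrow> i \<in> V'" "HPole b \<in> W" "RPole b \<in> W"
  by (cases b; auto simp: W_def)+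

lemma sum_W:
  fixes F :: "'a dvert \<Rightarrow> 'c::comm_monoid_add"
  shows "sum F W = (\<Sum>i\<in>V'. F (Top i)) + (\<Sum>i\<in>V'. F (Bot i)) +
    (F (HPole True) + F (HPole False) + F (RPole True) + F (RPole False))"
proof -
  have "sum F W = sum F (Top ` V' \<union> Bot ` V') +
      sum F {HPole True, HPole False, RPole True, RPole False}"
    unfolding W_def by (rule sum.union_disjoint) (use fin in auto)
  also have "sum F (Top ` V' \<union> Bot ` V') = sum F (Top ` V') + sum F (Bot ` V')"
    by (rule sum.union_disjoint) (use fin in auto)
  also have "sum F (Top ` V') = (\<Sum>i\<in>V'. F (Top i))"
    by (subst sum.reindex) (auto simp: inj_on_def)
  also have "sum F (Bot ` V') = (\<Sum>i\<in>V'. F (Bot i))"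
    by (subst sum.reindex) (auto simp: inj_on_def)
  finally show ?thesis by (simp add: add.assoc)
qed

lemma card_W: "card W = 2 * card V + 2"
proof -
  have "card V \<ge> 1" using v fin by (simp add: Suc_le_eq card_gt_0_iff) blast
  have "card W = (\<Sum>x\<in>W. 1)" by simp
  also have "\<dots> = 2 * card V' + 4" by (subst sum_W) simp
  finally show ?thesis using v fin \<open>card V \<ge> 1\<close> by (simp add: card_Diff_singleton)
qed

lemma S_diag: "x \<in> W \<Longrightarrow> S x x = 0"
  by (cases x) (auto simp: diag)

lemma S_sym: "x \<in> W \<Longrightarrow> y \<in> W \<Longrightarrow> S x y = S y x"
  by (cases x; cases y) (auto simp: sym)

lemma S_sign: "x \<in> W \<Longrightarrow> y \<in> W \<Longrightarrow> x \<noteq> y \<Longrightarrow> S x y = 1 \<or> S x y = -1"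
proof (cases x; cases y)
qed (use sign v in \<open>auto simp: sg_def diag split: if_splits\<close>)

section \<open>Row sums and inner products of rows of \<open>S\<close>\<close>

lemma S_row:
  "i \<in> V' \<Longrightarrow> (\<Sum>l\<in>W. S (Top i) l) = - r i"
  "i \<in> V' \<Longrightarrow> (\<Sum>l\<in>W. S (Bot i) l) = r i"
  "(\<Sum>l\<in>W. S (HPole b) l) = 1"
  "(\<Sum>l\<in>W. S (RPole b) l) = 1"
  by (simp_all add: sum_W sum.distrib sum_negf row_sums r_sum fin sg_def flip: sum_distrib_left)

lemma sum_diagonal_perturbation:
  fixes f :: "'a \<Rightarrow> int"
  assumes "j \<in> V'"
  shows "(\<Sum>l\<in>V'. f l * (Q j l + (if l = j then r j else 0))) = (\<Sum>l\<in>V'. f l * Q j l) + f j * r j"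
    and "(\<Sum>l\<in>V'. (Q j l + (if l = j then r j else 0)) * f l) = (\<Sum>l\<in>V'. f l * Q j l) + f j * r j"
proof -
  have "(\<Sum>l\<in>V'. f l * (Q j l + (if l = j then r j else 0))) =
      (\<Sum>l\<in>V'. f l * Q j l + (if l = j then f j * r j else 0))"
    by (rule sum.cong) (auto simp: algebra_simps)
  also have "\<dots> = (\<Sum>l\<in>V'. f l * Q j l) + f j * r j"
    using assms fin by (simp add: sum.distrib)
  finally show 1: "(\<Sum>l\<in>V'. f l * (Q j l + (if l = j then r j else 0))) = (\<Sum>l\<in>V'. f l * Q j l) + f j * r j" .
  then show "(\<Sum>l\<in>V'. (Q j l + (if l = j then r j else 0)) * f l) = (\<Sum>l\<in>V'. f l * Q j l) + f j * r j"
    by (simp add: mult.commute)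
qed

text \<open>Within one copy, the blocks \<open>Q\<close> and \<open>Q + diag r\<close> each
  contribute \<open>-1 - r i * r j\<close>, and the poles contribute
  \<open>2 + 2 * r i * r j\<close>. These cancel, leaving only the cross terms of \<open>Q\<close>
  with \<open>diag r\<close>.\<close>

lemma S_prod_base:
  assumes ij: "i \<in> V'" "j \<in> V'"
  shows "i \<noteq> j \<Longrightarrow> (\<Sum>l\<in>W. S (Top i) l * S (Top j) l) = Q i j * (r i + r j)"
    and "i \<noteq> j \<Longrightarrow> (\<Sum>l\<in>W. S (Bot i) l * S (Bot j) l) = Q i j * (r i + r j)"
    and "(\<Sum>l\<in>W. S (Top i) l * S (Bot j) l) = Q i j * (r j - r i) + 2 * r i * r j - 2"
proof -
  let ?E = "\<lambda>i l. Q i l + (if l = i then r i else 0)"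
  have sij: "Q j i = Q i j" using ij sym by simp
  have "(\<Sum>l\<in>V'. ?E i l * ?E j l) = -1 - r i * r j + Q i j * (r i + r j)" if "i \<noteq> j"
    using sum_diagonal_perturbation(1)[OF ij(2), of "?E i"]
      sum_diagonal_perturbation(2)[OF ij(1), of "Q j"] prod_sum[OF ij that] that sij
    by (simp add: mult.commute distrib_left)
  then show "(\<Sum>l\<in>W. S (Top i) l * S (Top j) l) = Q i j * (r i + r j)"
    and "(\<Sum>l\<in>W. S (Bot i) l * S (Bot j) l) = Q i j * (r i + r j)" if "i \<noteq> j"
    using prod_sum[OF ij that] that
    by (simp_all add: sum_W sg_def algebra_simps)
  \<comment> \<open>The opposite signs of the diagonal blocks cancel the square of \<open>Q\<close>;
    what remains is the commutator of \<open>Q\<close> with \<open>diag r\<close>.\<close>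
  have "(\<Sum>l\<in>V'. Q i l * ?E j l) + (\<Sum>l\<in>V'. ?E i l * - Q j l) = Q i j * (r j - r i)"
    using sum_diagonal_perturbation(1)[OF ij(2), of "Q i"]
      sum_diagonal_perturbation(2)[OF ij(1), of "Q j"] sij
    by (simp add: sum_negf mult.commute right_diff_distrib)
  then show "(\<Sum>l\<in>W. S (Top i) l * S (Bot j) l) = Q i j * (r j - r i) + 2 * r i * r j - 2"
    by (simp add: sum_W sg_def)
qed

lemma S_prod_pole:
  assumes i: "i \<in> V'"
  shows "(\<Sum>l\<in>W. S (Top i) l * S (HPole b) l) = sg b * (r i - 1)"
    and "(\<Sum>l\<in>W. S (Bot i) l * S (HPole b) l) = sg b * (r i + 1)"
    and "(\<Sum>l\<in>W. S (Top i) l * S (RPole b) l) = sg b * (1 - r i)"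
    and "(\<Sum>l\<in>W. S (Bot i) l * S (RPole b) l) = - sg b * (1 + r i)"
proof -
  let ?E = "\<lambda>l. Q i l + (if l = i then r i else 0)"
  \<comment> \<open>The perturbation by \<open>diag r\<close> makes the rows of the mixed block
    orthogonal to both the constant vector and \<open>r\<close>, so only the blocks \<open>Q\<close>
    and \<open>-Q\<close> and the poles contribute.\<close>
  have "(\<Sum>l\<in>V'. ?E l) = 0" "(\<Sum>l\<in>V'. ?E l * r l) = 0"
    using i fin row_sums[OF i] r_sq[OF i] sum_diagonal_perturbation(2)[OF i, of r]
    by (simp_all add: sum.distrib mult.commute)
  then have E: "(\<Sum>l\<in>V'. ?E l * a) = 0" "(\<Sum>l\<in>V'. ?E l * (a * r l)) = 0" for a
    by (simp_all add: mult.left_commute flip: sum_distrib_left sum_distrib_right)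
  have Q: "(\<Sum>l\<in>V'. Q i l * a) = - a * r i" "(\<Sum>l\<in>V'. Q i l * (a * r l)) = - a"
    "(\<Sum>l\<in>V'. - Q i l * a) = a * r i" "(\<Sum>l\<in>V'. - Q i l * (a * r l)) = a" for a
    using row_sums[OF i]
    by (simp_all add: mult.left_commute[of _ a] sum_negf flip: sum_distrib_left sum_distrib_right)
  show "(\<Sum>l\<in>W. S (Top i) l * S (HPole b) l) = sg b * (r i - 1)"
    "(\<Sum>l\<in>W. S (Bot i) l * S (HPole b) l) = sg b * (r i + 1)"
    "(\<Sum>l\<in>W. S (Top i) l * S (RPole b) l) = sg b * (1 - r i)"
    "(\<Sum>l\<in>W. S (Bot i) l * S (RPole b) l) = - sg b * (1 + r i)"
    unfolding sum_W S.simps E Q by (cases b; simp add: sg_def)+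
qed

text \<open>Opposite poles of one kind have opposite entries on both copies, which contribute at
  most 0, and the two poles of the other kind give -2. For poles of different kinds the copies
  contribute 0, and the two opposite poles each give \<open>- sg b * sg c\<close>.\<close>

lemma S_prod_poles:
  "b \<noteq> c \<Longrightarrow> (\<Sum>l\<in>W. S (HPole b) l * S (HPole c) l) \<le> -2"
  "b \<noteq> c \<Longrightarrow> (\<Sum>l\<in>W. S (RPole b) l * S (RPole c) l) \<le> -2"
  "(\<Sum>l\<in>W. S (HPole b) l * S (RPole c) l) = - 2 * sg b * sg c"
proof -
  have sq: "0 \<le> (\<Sum>l\<in>V'. r l * r l)" by (simp add: sum_nonneg)
  show "b \<noteq> c \<Longrightarrow> (\<Sum>l\<in>W. S (HPole b) l * S (HPole c) l) \<le> -2"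
    "b \<noteq> c \<Longrightarrow> (\<Sum>l\<in>W. S (RPole b) l * S (RPole c) l) \<le> -2"
    "(\<Sum>l\<in>W. S (HPole b) l * S (RPole c) l) = - 2 * sg b * sg c"
    using sq by (cases b; cases c; simp add: sum_W sg_def sum_negf r_sum)+
qed

text \<open>Equality holds for pairs within one copy, for a copy vertex with a pole, and for poles
  of different kinds. Slack is possible only between the two copies and between opposite poles of
  one kind.\<close>

lemma balanced:
  assumes xy: "x \<in> W" "y \<in> W" "x \<noteq> y"
  shows "S x y * ((\<Sum>l\<in>W. S x l) + (\<Sum>l\<in>W. S y l)) + (\<Sum>l\<in>W. S x l * S y l) \<le> 0"
proof -
  define E where "E x y = S x y * ((\<Sum>l\<in>W. S x l) + (\<Sum>l\<in>W. S y l)) + (\<Sum>l\<in>W. S x l * S y l)" for x y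
  have comm: "E y x = E x y" using S_sym[OF xy(1,2)] by (simp add: E_def add.commute mult.commute)
  \<comment> \<open>The value is \<open>2 * Q i j * (r j - r i) + 2 * r i * r j - 2\<close>: it is 0
    if \<open>r i = r j\<close>, and otherwise at most 4 - 4.\<close>
  have TB: "E (Top i) (Bot j) \<le> 0" if "i \<in> V'" "j \<in> V'" for i j
    using that r_sq[of i] r_sq[of j] sign[of i v] sign[of j v] sign[of i j] v
    by (cases "i = j") (auto simp: E_def S_row S_prod_base diag)
  have TH: "E (Top i) (HPole b) \<le> 0" "E (Bot i) (HPole b) \<le> 0"
    "E (Top i) (RPole b) \<le> 0" "E (Bot i) (RPole b) \<le> 0" if "i \<in> V'" for i b
    using r_sq[OF that]
    by (simp_all only: E_def S_row(1,2)[OF that] S_row(3,4) S_prod_pole[OF that] S.simps)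
      (simp_all add: algebra_simps)
  have HR: "E (HPole b) (RPole c) \<le> 0" for b c
    by (simp add: E_def S_row S_prod_poles)
  have "E x y \<le> 0"
  proof (cases x; cases y)
    fix i j assume "x = Top i" "y = Top j"
    then show ?thesis using xy by (simp add: E_def S_row S_prod_base algebra_simps)
  next
    fix i j assume "x = Bot i" "y = Bot j"
    then show ?thesis using xy by (simp add: E_def S_row S_prod_base algebra_simps)
  next
    fix b c assume "x = HPole b" "y = HPole c"
    then show ?thesis using xy S_prod_poles(1)[of b c] by (simp add: E_def S_row)
  next
    fix b c assume "x = RPole b" "y = RPole c"
    then show ?thesis using xy S_prod_poles(2)[of b c] by (simp add: E_def S_row)
  \<comment> \<open>The remaining cases are pairs of different kinds, in either order.\<close>
  qed (metis xy(1,2) comm TB TH HR W_simps(1,2))+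
  then show ?thesis by (simp only: E_def)
qed

end

section \<open>Pseudo-cyclic graphs as conference graphs\<close>

text \<open>The negative of the usual Seidel matrix, which has -1 on edges.\<close>

definition seidel :: "'a ugraph \<Rightarrow> 'a \<Rightarrow> 'a \<Rightarrow> int" where
  "seidel G u w = (if u = w then 0 else if {u, w} \<in> edges G then 1 else -1)"

lemma pc_graph_conference:
  assumes pc: "pc_graph G q" and v: "v \<in> verts G"
  shows "conference_graph (verts G) (seidel G) v"
proof
  let ?V = "verts G" and ?N = "nbhd G"
  have fin: "finite ?V" and q: "card ?V = q" and simple: "edges G \<subseteq> nsets ?V 2"
    using pc by (auto simp: pc_graph_def strongly_regular_def finite_simple_graph_def)
  have deg: "2 * int (card (?N i)) = int q - 1" if "i \<in> ?V" for i
    using pc that unfolding pc_graph_def strongly_regular_def by force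
  have adj: "4 * int (card (?N i \<inter> ?N j)) = int q - 5"
    if "i \<in> ?V" "j \<in> ?V" "i \<noteq> j" "{i, j} \<in> edges G" for i j
  proof -
    have "real (card (?N i \<inter> ?N j)) = (real q - 5) / 4"
      using pc that unfolding pc_graph_def strongly_regular_def by blast
    then show ?thesis by (simp add: field_simps)
  qed
  have nadj: "4 * int (card (?N i \<inter> ?N j)) = int q - 1"
    if "i \<in> ?V" "j \<in> ?V" "i \<noteq> j" "{i, j} \<notin> edges G" for i j
  proof -
    have "real (card (?N i \<inter> ?N j)) = (real q - 1) / 4"
      using pc that unfolding pc_graph_def strongly_regular_def by blast
    then show ?thesis by (simp add: field_simps)
  qed
  have irr: "{i, i} \<notin> edges G" for i using simple by (auto simp: nsets_def)
  have Q: "seidel G i l = 2 * of_bool (l \<in> ?N i) - 1 + of_bool (l = i)" if "l \<in> ?V" for i l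
    using that irr by (auto simp: seidel_def nbhd_def insert_commute)
  have count: "(\<Sum>l\<in>?V. of_bool (l \<in> A)) = int (card A)" if "A \<subseteq> ?V" for A
    using fin that by (simp add: Int_absorb1)
  have N_sub: "?N i \<subseteq> ?V" for i by (auto simp: nbhd_def)
  note N = count[OF N_sub]
  show "finite ?V" "v \<in> ?V" by fact+
  show "seidel G i i = 0" for i by (simp add: seidel_def)
  show "seidel G i j = 1 \<or> seidel G i j = -1" if "i \<noteq> j" for i j
    using that by (simp add: seidel_def)
  show "seidel G i j = seidel G j i" for i j by (simp add: seidel_def insert_commute)
  show "(\<Sum>l\<in>?V. seidel G i l) = 0" if i: "i \<in> ?V" for i
  proof -
    have "(\<Sum>l\<in>?V. seidel G i l) = (\<Sum>l\<in>?V. 2 * of_bool (l \<in> ?N i) - 1 + of_bool (l = i))"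
      by (rule sum.cong) (auto simp: Q)
    also have "\<dots> = 2 * int (card (?N i)) - int q + 1"
      using fin i q N by (simp add: sum.distrib sum_subtractf flip: sum_distrib_left)
    finally show ?thesis using deg[OF i] by simp
  qed
  show "(\<Sum>l\<in>?V. seidel G i l * seidel G j l) = -1"
    if ij: "i \<in> ?V" "j \<in> ?V" "i \<noteq> j" for i j
  proof -
    \<comment> \<open>This multiplies out two rows of \<open>2A - J + I\<close>, with
      \<open>A\<close> the adjacency matrix; the two diagonal corrections never meet because
      \<open>i \<noteq> j\<close>.\<close>
    have "(\<Sum>l\<in>?V. seidel G i l * seidel G j l) =
      (\<Sum>l\<in>?V. 4 * of_bool (l \<in> ?N i \<inter> ?N j) - 2 * of_bool (l \<in> ?N i) - 2 * of_bool (l \<in> ?N j) + 1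
        + (if l = i then 2 * of_bool (i \<in> ?N j) - 1 else 0)
        + (if l = j then 2 * of_bool (j \<in> ?N i) - 1 else 0))"
      by (rule sum.cong[OF refl]) (use ij irr in \<open>auto simp: Q nbhd_def\<close>)
    also have "\<dots> = 4 * int (card (?N i \<inter> ?N j)) - 2 * int (card (?N i)) - 2 * int (card (?N j)) + int q
        + (2 * of_bool (i \<in> ?N j) - 1) + (2 * of_bool (j \<in> ?N i) - 1)"
    proof -
      have "(\<Sum>l\<in>?V. of_bool (l \<in> ?N i \<inter> ?N j)) = int (card (?N i \<inter> ?N j))"
        using N_sub by (intro count) blast
      then show ?thesis
        using fin ij q N by (simp add: sum.distrib sum_subtractf flip: sum_distrib_left)
    qed
    finally show ?thesis
      using deg[OF ij(1)] deg[OF ij(2)] adj[OF ij] nadj[OF ij] ij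
      by (cases "{i, j} \<in> edges G") (auto simp: nbhd_def insert_commute)
  qed
qed

section \<open>Ramsey numbers and books\<close>

lemma contains_copy_clique:
  assumes H: "finite_simple_graph H" and R: "finite R" "R \<subseteq> verts G" "card R = card (verts H)"
    "clique R (edges G)"
  shows "contains_copy G H"
proof -
  have "finite (verts H)" using H by (simp add: finite_simple_graph_def)
  then obtain f where f: "bij_betw f (verts H) R"
    using R(1,3) finite_same_card_bij by metis
  have "f ` e \<in> edges G" if "e \<in> edges H" for e
  proof -
    have "e \<in> nsets (verts H) 2" using H that by (auto simp: finite_simple_graph_def)
    then obtain x y where e: "e = {x, y}" "x \<in> verts H" "y \<in> verts H" "x \<noteq> y"
      by (rule nsets2_E)
    then have "f x \<in> R" "f y \<in> R" "f x \<noteq> f y"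
      using f by (auto simp: bij_betw_def inj_on_def)
    then show ?thesis using R(4) e by (auto simp: clique_def)
  qed
  then show ?thesis
    using f R(2) unfolding contains_copy_def bij_betw_def by blast
qed

text \<open>The \<open>LEAST\<close> is meaningful only if some \<open>N\<close> qualifies. Ramsey's
  theorem gives one: a monochromatic clique of the order of \<open>G\<close> or \<open>H\<close>
  contains that graph.\<close>

lemma ramsey_number_property:
  assumes "finite_simple_graph G" "finite_simple_graph H"
  shows "contains_copy (colour_class (ramsey_number G H) c Red) G
    \<or> contains_copy (colour_class (ramsey_number G H) c Blue) H"
proof -
  let ?P = "\<lambda>N. \<forall>c. contains_copy (colour_class N c Red) G \<or> contains_copy (colour_class N c Blue) H"
  obtain N where N: "\<forall>(V::nat set) E. finite V \<and> card V \<ge> N \<longrightarrow>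
    (\<exists>R \<subseteq> V. card R = card (verts G) \<and> clique R E \<or> card R = card (verts H) \<and> indep R E)"
    using ramsey2 by blast
  have "?P N"
  proof
    fix c
    let ?E = "edges (colour_class N c Red)"
    obtain R where R: "R \<subseteq> {..<N}"
      "card R = card (verts G) \<and> clique R ?E \<or> card R = card (verts H) \<and> indep R ?E"
      using N[rule_format, of "{..<N}" ?E] by auto
    have "finite R" using R(1) finite_subset by blast
    have "clique R (edges (colour_class N c Blue))" if "indep R ?E"
      unfolding clique_def
    proof (intro ballI impI)
      fix x y assume "x \<in> R" "y \<in> R" "x \<noteq> y"
      then show "{x, y} \<in> edges (colour_class N c Blue)"
        using that R(1) by (cases "c {x, y}") (auto simp: indep_def colour_class_def complete_graph_def)
    qed
    moreover have "R \<subseteq> verts (colour_class N c i)" for i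
      using R(1) by (simp add: colour_class_def complete_graph_def)
    ultimately show "contains_copy (colour_class N c Red) G \<or> contains_copy (colour_class N c Blue) H"
      using R(2) \<open>finite R\<close> assms contains_copy_clique by metis
  qed
  then have "?P (ramsey_number G H)"
    unfolding ramsey_number_def by (rule LeastI)
  then show ?thesis by blast
qed

section \<open>Books and colourings from signed matrices\<close>

lemma finite_simple_book: "finite_simple_graph (book_graph n)"
proof -
  have "Inl ` e \<in> nsets (A <+> B) 2" if "e \<in> nsets A 2" for e :: "nat set" and A and B :: "nat set"
    using that by (elim nsets2_E) auto
  moreover have "Inr ` e \<in> nsets (A <+> B) 2" if "e \<in> nsets B 2" for e :: "nat set" and A :: "nat set" and B
    using that by (elim nsets2_E) auto
  ultimately show ?thesis
    by (auto simp: finite_simple_graph_def book_graph_def graph_join_def complete_graph_def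
        graph_complement_def)
qed

lemma book_copyE:
  assumes "contains_copy G (book_graph n)"
  obtains x y C where "x \<in> verts G" "y \<in> verts G" "x \<noteq> y" "{x, y} \<in> edges G"
    "C \<subseteq> verts G - {x, y}" "card C = n" "\<And>z. z \<in> C \<Longrightarrow> {x, z} \<in> edges G \<and> {y, z} \<in> edges G"
proof -
  obtain f where f: "inj_on f ({..<2} <+> {..<n})" "f ` ({..<2} <+> {..<n}) \<subseteq> verts G"
      "\<forall>e\<in>edges (book_graph n). f ` e \<in> edges G"
    using assms by (auto simp: contains_copy_def book_graph_def graph_join_def complete_graph_def
        graph_complement_def)
  have e: "{Inl 0, Inl 1} \<in> edges (book_graph n)"
    "\<And>a k. a < 2 \<Longrightarrow> k < n \<Longrightarrow> {Inl a, Inr k} \<in> edges (book_graph n)"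
    by (auto simp: book_graph_def graph_join_def complete_graph_def graph_complement_def
        intro!: rev_image_eqI[of "{0, 1}"])
  show thesis
  proof
    show "f (Inl 0) \<in> verts G" "f (Inl 1) \<in> verts G" using f(2) by (auto simp: image_subset_iff)
    show "f (Inl 0) \<noteq> f (Inl 1)" using inj_onD[OF f(1), of "Inl 0" "Inl 1"] by force
    show "{f (Inl 0), f (Inl 1)} \<in> edges G" using bspec[OF f(3) e(1)] by simp
    show "(f \<circ> Inr) ` {..<n} \<subseteq> verts G - {f (Inl 0), f (Inl 1)}"
      using f(1,2) by (auto dest: inj_onD)
    have "inj_on (f \<circ> Inr) {..<n}" using f(1) by (auto simp: inj_on_def)
    then show "card ((f \<circ> Inr) ` {..<n}) = n" by (metis card_image card_lessThan)
    fix z assume "z \<in> (f \<circ> Inr) ` {..<n}"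
    then obtain k where k: "k < n" "z = f (Inr k)" by auto
    show "{f (Inl 0), z} \<in> edges G \<and> {f (Inl 1), z} \<in> edges G"
      using bspec[OF f(3) e(2)[of 0 k]] bspec[OF f(3) e(2)[of 1 k]] k by simp
  qed
qed

text \<open>If the Ramsey number \<open>N\<close> were at most \<open>card W\<close>, the signs on
  \<open>N\<close> vertices of \<open>W\<close> would colour the complete graph of order
  \<open>N\<close>, and a monochromatic book there would have \<open>n\<close> pages on one spine,
  against \<open>codeg\<close>.\<close>

lemma ramsey_book_lower_bound:
  fixes S :: "'b \<Rightarrow> 'b \<Rightarrow> int"
  assumes W: "finite W"
    and sym: "\<And>x y. x \<in> W \<Longrightarrow> y \<in> W \<Longrightarrow> S x y = S y x"
    and sign: "\<And>x y. x \<in> W \<Longrightarrow> y \<in> W \<Longrightarrow> x \<noteq> y \<Longrightarrow> S x y = 1 \<or> S x y = -1"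
    and codeg: "\<And>x y. x \<in> W \<Longrightarrow> y \<in> W \<Longrightarrow> x \<noteq> y \<Longrightarrow>
      card {z \<in> W - {x, y}. S x z = S x y \<and> S y z = S x y} < n"
  shows "ramsey_number (book_graph n) (book_graph n) > card W"
proof (rule ccontr)
  define N where "N = ramsey_number (book_graph n) (book_graph n)"
  assume "\<not> ?thesis"
  then have N: "N \<le> card W" by (simp add: N_def)
  obtain \<phi> where \<phi>: "bij_betw \<phi> {..<card W} W"
    using ex_bij_betw_nat_finite[OF W] by (auto simp: lessThan_atLeast0)
  have inj: "inj_on \<phi> {..<N}" and img: "\<And>x. x < N \<Longrightarrow> \<phi> x \<in> W"
    using \<phi> N by (auto simp: bij_betw_def inj_on_def)
  define val :: "colour \<Rightarrow> int" where "val i = (if i = Red then 1 else -1)" for i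
  define c where "c e = (if \<exists>x y. e = {x, y} \<and> x < N \<and> y < N \<and> S (\<phi> x) (\<phi> y) = 1 then Red else Blue)" for e
  have c: "S (\<phi> x) (\<phi> y) = val (c {x, y})" if "x < N" "y < N" "x \<noteq> y" for x y
  proof -
    \<comment> \<open>By symmetry of \<open>S\<close>, the colour does not depend on the order in
      which the endpoints are read.\<close>
    have "c {x, y} = (if S (\<phi> x) (\<phi> y) = 1 then Red else Blue)"
      unfolding c_def using that sym[OF img img] by (auto simp: doubleton_eq_iff)
    moreover have "\<phi> x \<noteq> \<phi> y" using inj that by (auto simp: inj_on_def)
    ultimately show ?thesis using sign[OF img img] that by (auto simp: val_def)
  qed
  obtain i where "contains_copy (colour_class N c i) (book_graph n)"
    using ramsey_number_property[OF finite_simple_book finite_simple_book] unfolding N_def by blast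
  then obtain x y C where xy: "x < N" "y < N" "x \<noteq> y" "c {x, y} = i"
    and C: "C \<subseteq> {..<N} - {x, y}" "card C = n" "\<And>z. z \<in> C \<Longrightarrow> c {x, z} = i \<and> c {y, z} = i"
    by (elim book_copyE) (auto simp: colour_class_def complete_graph_def)
  have ne: "\<phi> x \<noteq> \<phi> y" using inj xy by (auto simp: inj_on_def)
  have "\<phi> ` C \<subseteq> {z \<in> W - {\<phi> x, \<phi> y}. S (\<phi> x) z = S (\<phi> x) (\<phi> y) \<and> S (\<phi> y) z = S (\<phi> x) (\<phi> y)}"
  proof
    fix w assume "w \<in> \<phi> ` C"
    then obtain z where z: "z \<in> C" "w = \<phi> z" by blast
    then have zN: "z < N" "z \<noteq> x" "z \<noteq> y" using C(1) by auto
    then have "\<phi> z \<noteq> \<phi> x" "\<phi> z \<noteq> \<phi> y" using inj xy by (auto simp: inj_on_def)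
    then show "w \<in> {z \<in> W - {\<phi> x, \<phi> y}. S (\<phi> x) z = S (\<phi> x) (\<phi> y) \<and> S (\<phi> y) z = S (\<phi> x) (\<phi> y)}"
      using z zN c xy C(3)[OF z(1)] img by auto
  qed
  then have "card (\<phi> ` C) \<le> card {z \<in> W - {\<phi> x, \<phi> y}. S (\<phi> x) z = S (\<phi> x) (\<phi> y) \<and> S (\<phi> y) z = S (\<phi> x) (\<phi> y)}"
    by (rule card_mono[rotated]) (use W in simp)
  moreover have "card (\<phi> ` C) = n"
    using C(1,2) inj by (metis Diff_subset card_image inj_on_subset subset_trans)
  ultimately show False using codeg[OF img img ne] xy by simp
qed

theorem theorem1p1:
  fixes n :: nat
  assumes "n \<ge> 1"
    and "\<exists>G :: 'a ugraph. pc_graph G (2 * n - 1)"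
  shows "ramsey_number (book_graph n) (book_graph n) \<ge> 4 * n + 1"
proof -
  obtain G :: "'a ugraph" where G: "pc_graph G (2 * n - 1)" using assms(2) by blast
  then have card: "card (verts G) = 2 * n - 1"
    by (simp add: pc_graph_def strongly_regular_def)
  then have "verts G \<noteq> {}" using assms(1) by auto
  then obtain v where "v \<in> verts G" by blast
  then interpret conference_graph "verts G" "seidel G" v
    using pc_graph_conference G by metis
  \<comment> \<open>\<open>2 * (2 * n - 1) + 2 = 4 * n\<close>; the subtraction is exact because
    \<open>n \<ge> 1\<close>.\<close>
  have W: "card W = 4 * n" using card_W card assms(1) by simp
  have "card W < ramsey_number (book_graph n) (book_graph n)"
  proof (rule ramsey_book_lower_bound[of W S])
    show "card {z \<in> W - {x, y}. S x z = S x y \<and> S y z = S x y} < n"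
      if "x \<in> W" "y \<in> W" "x \<noteq> y" for x y
      by (rule monochromatic_codegree_bound)
        (fact that finite_W W S_diag S_sign S_sym[OF that(2,1)] balanced[OF that])+
  qed (use finite_W S_sym S_sign in auto)
  then show ?thesis using W by simp
qed

end
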